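(* Let $0<v<+\infty$, $\alpha>0$, $c>0$, $\mu=\int_0^{+\infty}(1-F(z))\,dz<\infty$ and $\alpha\mu/c<1$. Let $$\varphi^{k+1}(u)=1-\frac{\alpha\mu}{c}+\frac{\alpha}{c}\int_0^u\varphi^k(u-z)[1-F(z)]\,dz,\qquad u\in[0,v],\ k=0,1,\dots$$ (i) If $\varphi^0(u)\equiv1-\alpha\mu/c$, then for each $u\in[0,v]$ the sequence $\{\varphi^k(u)\}_{k\ge0}$ is nondecreasing in $k$. (ii) If $\varphi^0(u)\equiv1$, then for each $u\in[0,v]$ the sequence $\{\varphi^k(u)\}_{k\ge0}$ is nonincreasing in $k$.
   Context: $F$ is the distribution function of claim sizes, $F(z)=0$ for $z\le0$, with mean $\mu$. *)

theory Defs
  imports "HOL-Probability.Probability"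
begin

end

theory Submission
  imports Defs
begin

text \<open>The operator on the right-hand side of the recursion preserves the class of nonnegative,
  nondecreasing functions on \<open>[0,v]\<close> and is monotone in its argument; nondecreasing functions are
  Borel, so every integrand is integrable. Comparing the first two iterates and
  propagating the inequality by induction gives both claims.\<close>

text \<open>Clamping the argument to [0,v] extends \<open>g\<close> to a monotone function on the
  whole line, which is Borel and bounded by \<open>\<bar>g v\<bar>\<close>. The integrand is then
  dominated by a constant multiple of the integrable weight \<open>w\<close>.\<close>

lemma set_integrable_mono_convolution:
  fixes g w :: "real \<Rightarrow> real"
  assumes g: "mono_on {0..v} g" "\<And>x. x \<in> {0..v} \<Longrightarrow> 0 \<le> g x"
    and w: "set_integrable lborel {0..} w" and u: "u \<in> {0..v}"
  shows "set_integrable lborel {0..u} (\<lambda>z. g (u - z) * w z)"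
proof -
  define G where "G x = g (max 0 (min v x))" for x
  have "mono G"
    using u by (auto simp: G_def mono_def intro!: mono_onD[OF g(1)])
  then have [measurable]: "G \<in> borel_measurable borel"
    by (rule borel_measurable_mono)
  have wu: "set_integrable lborel {0..u} w"
    by (rule set_integrable_subset[OF w]) auto
  then have int: "integrable lborel (\<lambda>z. g v * (indicator {0..u} z * w z))"
    by (simp add: set_integrable_def)
  have [measurable]: "(\<lambda>z. indicator {0..u} z * w z) \<in> borel_measurable borel"
    using wu borel_measurable_integrable by (fastforce simp: set_integrable_def)
  have bound: "\<bar>G x\<bar> \<le> \<bar>g v\<bar>" for x
  proof -
    have "0 \<le> G x" "G x \<le> g v"
      using u by (auto simp: G_def intro!: g(2) mono_onD[OF g(1)])
    then show ?thesis by simp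
  qed
  have "integrable lborel (\<lambda>z. G (u - z) * (indicator {0..u} z * w z))"
    by (rule Bochner_Integration.integrable_bound[OF int])
       (auto simp: abs_mult intro!: mult_right_mono bound)
  \<comment> \<open>For z in [0,u] the point u - z lies in [0,v], where clamping changes nothing;
    elsewhere both sides vanish.\<close>
  also have "(\<lambda>z. G (u - z) * (indicator {0..u} z * w z))
      = (\<lambda>z. indicator {0..u} z *\<^sub>R (g (u - z) * w z))"
    using u by (auto simp: G_def indicator_def fun_eq_iff)
  finally show ?thesis
    by (simp add: set_integrable_def)
qed

text \<open>On [0,u] the integrands compare through \<open>h (u - z)\<close>, and the rest of [0,u']
  only adds a nonnegative amount. The case \<open>g = h\<close> shows that the recursion preserves
  monotonicity in \<open>u\<close>; the case \<open>u = u'\<close> shows that it preserves the order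
  between functions.\<close>

lemma set_integral_mono_convolution_le:
  fixes g h w :: "real \<Rightarrow> real"
  assumes g: "mono_on {0..v} g" "\<And>x. x \<in> {0..v} \<Longrightarrow> 0 \<le> g x"
    and h: "mono_on {0..v} h" "\<And>x. x \<in> {0..v} \<Longrightarrow> 0 \<le> h x"
    and gh: "\<And>x. x \<in> {0..v} \<Longrightarrow> g x \<le> h x"
    and w: "set_integrable lborel {0..} w" "\<And>z. 0 \<le> z \<Longrightarrow> 0 \<le> w z"
    and u: "0 \<le> u" "u \<le> u'" "u' \<le> v"
  shows "(LBINT z:{0..u}. g (u - z) * w z) \<le> (LBINT z:{0..u'}. h (u' - z) * w z)"
  unfolding set_lebesgue_integral_def
proof (rule integral_mono)
  show "integrable lborel (\<lambda>z. indicator {0..u} z *\<^sub>R (g (u - z) * w z))"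
    using set_integrable_mono_convolution[OF g w(1), of u] u by (simp add: set_integrable_def)
  show "integrable lborel (\<lambda>z. indicator {0..u'} z *\<^sub>R (h (u' - z) * w z))"
    using set_integrable_mono_convolution[OF h w(1), of u'] u by (simp add: set_integrable_def)
next
  fix z
  have "g (u - z) \<le> h (u' - z)" if "z \<in> {0..u}"
  proof -
    have "g (u - z) \<le> h (u - z)" using that u by (intro gh) auto
    also have "\<dots> \<le> h (u' - z)" using that u by (intro mono_onD[OF h(1)]) auto
    finally show ?thesis .
  qed
  then show "indicator {0..u} z *\<^sub>R (g (u - z) * w z) \<le> indicator {0..u'} z *\<^sub>R (h (u' - z) * w z)"
    using u w(2)[of z] h(2)[of "u' - z"] by (auto simp: indicator_def intro: mult_right_mono)
qed

theorem lemma3p1: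
  fixes M :: "real measure" and F :: "real \<Rightarrow> real"
    and v \<alpha> c \<mu> :: real and \<phi> :: "nat \<Rightarrow> real \<Rightarrow> real"
  assumes "real_distribution M" and "F = cdf M"
    and "\<And>z. z \<le> 0 \<Longrightarrow> F z = 0"
    and "0 < v" and "\<alpha> > 0" and "c > 0"
    and "set_integrable lborel {0..} (\<lambda>z. 1 - F z)"
    and "\<mu> = (LBINT z:{0..}. 1 - F z)"
    and "\<alpha> * \<mu> / c < 1"
    and "\<And>k u. u \<in> {0..v} \<Longrightarrow>
           \<phi> (Suc k) u = 1 - \<alpha> * \<mu> / c + \<alpha> / c * (LBINT z:{0..u}. \<phi> k (u - z) * (1 - F z))"
  shows "((\<forall>u\<in>{0..v}. \<phi> 0 u = 1 - \<alpha> * \<mu> / c) \<longrightarrow> (\<forall>u\<in>{0..v}. incseq (\<lambda>k. \<phi> k u))) \<and>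
         ((\<forall>u\<in>{0..v}. \<phi> 0 u = 1) \<longrightarrow> (\<forall>u\<in>{0..v}. decseq (\<lambda>k. \<phi> k u)))"
proof -
  interpret real_distribution M by fact
  have w: "0 \<le> 1 - F z" for z
    using cdf_bounded_prob[of z] by (simp add: assms(2))
  note wint = assms(7) and rec = assms(10)
  have ac: "0 \<le> \<alpha> / c" using assms(5,6) by simp
  have nonneg: "0 \<le> (LBINT z:{0..u}. \<phi> k (u - z) * (1 - F z))"
    if "u \<in> {0..v}" "\<And>x. x \<in> {0..v} \<Longrightarrow> 0 \<le> \<phi> k x" for k u
    unfolding set_lebesgue_integral_def
    using that w by (intro integral_nonneg_AE AE_I2) (auto simp: indicator_def)
  \<comment> \<open>The constant \<open>a\<close> stands for either starting value, so that one
    induction serves both claims.\<close>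
  have invariant: "mono_on {0..v} (\<phi> k) \<and> (\<forall>x\<in>{0..v}. 0 \<le> \<phi> k x)"
    if "\<And>u. u \<in> {0..v} \<Longrightarrow> \<phi> 0 u = a" "0 \<le> a" for k a
  proof (induction k)
    case 0
    show ?case using that by (auto simp: mono_on_def)
  next
    case (Suc k)
    \<comment> \<open>The comparison lemma with both functions equal to \<open>\<phi> k\<close> and
      upper limits r \<le> s.\<close>
    have "\<phi> (Suc k) r \<le> \<phi> (Suc k) s" if "r \<in> {0..v}" "s \<in> {0..v}" "r \<le> s" for r s
      unfolding rec[OF that(1)] rec[OF that(2)]
      using Suc that w ac
      by (intro add_left_mono mult_left_mono set_integral_mono_convolution_le[OF _ _ _ _ _ wint])
         auto
    \<comment> \<open>The condition \<open>\<alpha> * \<mu> / c < 1\<close> makes the constant term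
      of the recursion positive.\<close>
    moreover have "0 \<le> \<phi> (Suc k) x" if "x \<in> {0..v}" for x
      unfolding rec[OF that]
      using Suc that nonneg[OF that, of k] ac assms(9)
      by (intro add_nonneg_nonneg mult_nonneg_nonneg) auto
    ultimately show ?case by (auto simp: mono_on_def)
  qed
  \<comment> \<open>The indices \<open>j\<close> and \<open>k\<close> are left free: the pair (k,
    k+1) propagates the increasing case, the pair (k+1, k) the decreasing one.\<close>
  have step: "\<phi> (Suc j) u \<le> \<phi> (Suc k) u"
    if "\<And>u. u \<in> {0..v} \<Longrightarrow> \<phi> 0 u = a" "0 \<le> a"
      and "\<And>x. x \<in> {0..v} \<Longrightarrow> \<phi> j x \<le> \<phi> k x" "u \<in> {0..v}" for j k u a
    unfolding rec[OF that(4)]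
    using invariant[OF that(1,2), of j] invariant[OF that(1,2), of k] that(3,4) w ac
    by (intro add_left_mono mult_left_mono set_integral_mono_convolution_le[OF _ _ _ _ _ wint]) auto
  show ?thesis
  proof (intro conjI impI ballI)
    fix u
    assume init: "\<forall>u\<in>{0..v}. \<phi> 0 u = 1 - \<alpha> * \<mu> / c" and u: "u \<in> {0..v}"
    have "\<forall>u\<in>{0..v}. \<phi> k u \<le> \<phi> (Suc k) u" for k
    proof (induction k)
      case 0
      \<comment> \<open>The first iterate is the starting constant plus a nonnegative integral
        term.\<close>
      show ?case
        using init assms(9) mult_nonneg_nonneg[OF ac nonneg[of _ 0]] rec[of _ 0] by auto
    next
      case (Suc k)
      show ?case using init assms(9) Suc by (intro ballI step[of "1 - \<alpha> * \<mu> / c"]) auto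
    qed
    with u show "incseq (\<lambda>k. \<phi> k u)" by (auto simp: incseq_Suc_iff)
  next
    fix u
    assume init: "\<forall>u\<in>{0..v}. \<phi> 0 u = 1" and u: "u \<in> {0..v}"
    have "\<forall>u\<in>{0..v}. \<phi> (Suc k) u \<le> \<phi> k u" for k
    proof (induction k)
      case 0
      \<comment> \<open>Starting from 1, the integral is that of \<open>1 - F z\<close> over [0,x],
        hence at most \<open>\<mu>\<close>; the added term is therefore at most the
        \<open>\<alpha> * \<mu> / c\<close> subtracted from 1.\<close>
      have "\<phi> (Suc 0) x \<le> \<phi> 0 x" if x: "x \<in> {0..v}" for x
      proof -
        have "(LBINT z:{0..x}. \<phi> 0 (x - z) * (1 - F z)) = (LBINT z:{0..x}. 1 - F z)"
          using init x by (intro set_lebesgue_integral_cong) auto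
        also have "\<dots> \<le> \<mu>"
          unfolding assms(8) set_lebesgue_integral_def
          using w wint set_integrable_subset[OF wint, of "{0..x}"]
          by (intro integral_mono) (auto simp: set_integrable_def indicator_def)
        finally have "\<alpha> / c * (LBINT z:{0..x}. \<phi> 0 (x - z) * (1 - F z)) \<le> \<alpha> / c * \<mu>"
          using ac by (rule mult_left_mono)
        then show ?thesis using init x rec[OF x, of 0] by simp
      qed
      then show ?case by blast
    next
      case (Suc k)
      show ?case using init Suc by (intro ballI step[of 1]) auto
    qed
    with u show "decseq (\<lambda>k. \<phi> k u)" by (auto simp: decseq_Suc_iff)
  qed
qed

end
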